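(* For every $\epsilon>0$ there is a deterministic online algorithm for the heterogeneous data-center right-sizing problem with (possibly) time-dependent operating cost functions $f_{t,j}$ that is $(2d+1+\epsilon)$-competitive, i.e. on every instance its schedule has cost at most $(2d+1+\epsilon)$ times the cost of an optimal schedule.
   Context: Notation: $[k]=\{1,\dots,k\}$, $[k]_0=\{0,\dots,k\}$, $(x)^+=\max(x,0)$. Problem: An instance consists of $T\in\mathbb N$ time slots, $d\in\mathbb N$ server types, numbers $m_1,\dots,m_d\in\mathbb N$ of servers of each type, switching costs $\beta_j>0$, capacities $z^{\max}_j>0$, job volumes $\lambda_t\ge 0$ ($t\in[T]$), and operating cost functions $f_{t,j}$ ($t\in[T]$, $j\in[d]$) that are convex, increasing and non-negative on $[0,z^{\max}_j]$ (taking the value $+\infty$ for loads above $z^{\max}_j$). For $x\in\mathbb N_0$, $z\in[0,1]$ put $g_{t,j}(x,z)=x f_{t,j}(\lambda_t z/x)$ if $x>0$, $g_{t,j}(0,z)=\infty$ if $\lambda_t z>0$, $g_{t,j}(0,z)=0$ if $\lambda_t z=0$. Let $\mathcal Z=\{(z_1,\dots,z_d)\in[0,1]^d:\sum_j z_j=1\}$ and $g_t(x_1,\dots,x_d)=\min_{z\in\mathcal Z}\sum_{j}g_{t,j}(x_j,z_j)$. A schedule is $X=(\vec x_1,\dots,\vec x_T)$, $\vec x_t=(x_{t,1},\dots,x_{t,d})$, $x_{t,j}\in[m_j]_0$, with $\vec x_0=\vec x_{T+1}=\vec 0$; it is feasible if also $\sum_j x_{t,j}z^{\max}_j\ge\lambda_t$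 for all $t$. Its cost is $C(X)=\sum_{t=1}^T\big(g_t(\vec x_t)+\sum_j\beta_j(x_{t,j}-x_{t-1,j})^+\big)$. An optimal schedule is a feasible schedule of minimum cost. Online setting: $T,d,\vec m,\vec\beta$ are known; at slot $t$ the algorithm learns $\lambda_t$ and $f_{t,1},\dots,f_{t,d}$ and must fix $\vec x_t$ without knowledge of later slots. A deterministic online algorithm is $c$-competitive if on every instance its cost is at most $c$ times the optimal cost. *)

theory Defs
  imports "HOL-Analysis.Analysis"
begin

text \<open>Time slots are \<open>{1..T}\<close> and server types are \<open>{1..d}\<close>; values of the fields below at
  other indices are irrelevant. Operating costs are extended-real valued, so a cost function
  determines its capacity as the last load of finite cost.\<close>

record dc_problem =
  horizon  :: nat                                    (* T *)
  ntypes   :: nat                                    (* d *)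
  servers  :: "nat \<Rightarrow> nat"                           (* m_j *)
  swcost   :: "nat \<Rightarrow> real"                          (* beta_j *)
  capacity :: "nat \<Rightarrow> real"                          (* z^max_j *)
  volume   :: "nat \<Rightarrow> real"                          (* lambda_t *)
  opcost   :: "nat \<Rightarrow> nat \<Rightarrow> real \<Rightarrow> ereal"           (* f_{t,j} *)

definition operating_cost_fun :: "real \<Rightarrow> (real \<Rightarrow> ereal) \<Rightarrow> bool" where
  "operating_cost_fun zmax f \<longleftrightarrow>
     (\<forall>z\<in>{0..zmax}. 0 \<le> f z \<and> f z < \<infinity>) \<and>
     mono_on {0..zmax} f \<and>
     convex_on {0..zmax} (\<lambda>z. real_of_ereal (f z)) \<and>
     (\<forall>z>zmax. f z = \<infinity>)"

definition dc_instance :: "dc_problem \<Rightarrow> bool" where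
  "dc_instance I \<longleftrightarrow>
     1 \<le> horizon I \<and> 1 \<le> ntypes I \<and>
     (\<forall>j\<in>{1..ntypes I}. 1 \<le> servers I j \<and> 0 < swcost I j \<and> 0 < capacity I j) \<and>
     (\<forall>t\<in>{1..horizon I}. 0 \<le> volume I t) \<and>
     (\<forall>t\<in>{1..horizon I}. \<forall>j\<in>{1..ntypes I}. operating_cost_fun (capacity I j) (opcost I t j))"

definition type_cost :: "dc_problem \<Rightarrow> nat \<Rightarrow> nat \<Rightarrow> nat \<Rightarrow> real \<Rightarrow> ereal" where
  "type_cost I t j x z =
     (if 0 < x then ereal (real x) * opcost I t j (volume I t * z / real x)
      else if 0 < volume I t * z then \<infinity> else 0)"

definition load_splits :: "nat \<Rightarrow> (nat \<Rightarrow> real) set" where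
  "load_splits d = {z. (\<forall>j\<in>{1..d}. 0 \<le> z j \<and> z j \<le> 1) \<and> (\<Sum>j=1..d. z j) = 1}"

text \<open>The minimum is rendered as an infimum: a convex function may jump upwards at the right
  end of \<open>[0, z\<^sup>m\<^sup>a\<^sup>x]\<close>, and then the minimum need not be attained.\<close>

definition slot_cost :: "dc_problem \<Rightarrow> nat \<Rightarrow> (nat \<Rightarrow> nat) \<Rightarrow> ereal" where
  "slot_cost I t x = (INF z\<in>load_splits (ntypes I). \<Sum>j=1..ntypes I. type_cost I t j (x j) (z j))"

type_synonym schedule = "nat \<Rightarrow> nat \<Rightarrow> nat"

definition is_schedule :: "dc_problem \<Rightarrow> schedule \<Rightarrow> bool" where
  "is_schedule I X \<longleftrightarrow>
     (\<forall>t\<in>{1..horizon I}. \<forall>j\<in>{1..ntypes I}. X t j \<le> servers I j) \<and>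
     (\<forall>j\<in>{1..ntypes I}. X 0 j = 0 \<and> X (horizon I + 1) j = 0)"

definition feasible :: "dc_problem \<Rightarrow> schedule \<Rightarrow> bool" where
  "feasible I X \<longleftrightarrow> is_schedule I X \<and>
     (\<forall>t\<in>{1..horizon I}. volume I t \<le> (\<Sum>j=1..ntypes I. real (X t j) * capacity I j))"

definition schedule_cost :: "dc_problem \<Rightarrow> schedule \<Rightarrow> ereal" where
  "schedule_cost I X =
     (\<Sum>t=1..horizon I. slot_cost I t (X t) +
        ereal (\<Sum>j=1..ntypes I. swcost I j * max (real (X t j) - real (X (t - 1) j)) 0))"

definition optimal :: "dc_problem \<Rightarrow> schedule \<Rightarrow> bool" where
  "optimal I X \<longleftrightarrow> feasible I X \<and> (\<forall>Y. feasible I Y \<longrightarrow> schedule_cost I X \<le> schedule_cost I Y)"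

definition same_information :: "nat \<Rightarrow> dc_problem \<Rightarrow> dc_problem \<Rightarrow> bool" where
  "same_information t I I' \<longleftrightarrow>
     horizon I = horizon I' \<and> ntypes I = ntypes I' \<and>
     (\<forall>j\<in>{1..ntypes I}. servers I j = servers I' j \<and> swcost I j = swcost I' j) \<and>
     (\<forall>s\<in>{1..t}. volume I s = volume I' s \<and>
        (\<forall>j\<in>{1..ntypes I}. \<forall>z\<ge>0. opcost I s j z = opcost I' s j z))"

text \<open>A deterministic online algorithm maps instances to schedules such that the decision for
  slot \<open>t\<close> is a function of the information revealed up to and including slot \<open>t\<close>.\<close>

definition online_algorithm :: "(dc_problem \<Rightarrow> schedule) \<Rightarrow> bool" where
  "online_algorithm A \<longleftrightarrow>
     (\<forall>I. dc_instance I \<longrightarrow> is_schedule I (A I)) \<and>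
     (\<forall>I I'. dc_instance I \<longrightarrow> dc_instance I' \<longrightarrow>
        (\<forall>t\<in>{1..horizon I}. same_information t I I' \<longrightarrow>
           (\<forall>j\<in>{1..ntypes I}. A I t j = A I' t j)))"

text \<open>Competitiveness on the instances with \<open>d\<close> server types. An instance whose job volumes
  exceed the total capacity has no feasible, hence no optimal, schedule.\<close>

definition competitive :: "(dc_problem \<Rightarrow> schedule) \<Rightarrow> nat \<Rightarrow> real \<Rightarrow> bool" where
  "competitive A d c \<longleftrightarrow>
     (\<forall>I. dc_instance I \<longrightarrow> ntypes I = d \<longrightarrow> (\<exists>X. feasible I X) \<longrightarrow>
        feasible I (A I) \<and>
        (\<forall>X. optimal I X \<longrightarrow> schedule_cost I (A I) \<le> ereal c * schedule_cost I X))"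

end

theory Submission
  imports Defs
begin

text \<open>In slot \<open>t\<close> the algorithm computes an optimal schedule for the first \<open>t\<close> slots and makes
  sure that at least the servers used by its last state, the demand, are running. The operating
  costs of the demands sum up to at most OPT, since truncating an optimal prefix schedule gives a
  competitor on the shorter prefix.

  Servers beyond the demand are handled as in ski rental: a server is shut down as soon as its
  idle cost since it was last demanded would exceed \<open>\<beta>\<^sub>j\<close>. Keeping it costs at most its idle
  cost by convexity. Call the debt of a server its idle cost since the last demand, capped at
  \<open>\<beta>\<^sub>j\<close>, and \<open>\<beta>\<^sub>j\<close> before the first demand. Debts collected when servers are demanded are a lower bound on OPT for each type \<open>j\<close>
  separately, by an invariant on the work function, and switching plus idle costs are at most
  twice the collected debts. This gives the factor \<open>2 d + 1\<close>; because \<open>f\<^sub>t\<^sub>,\<^sub>j\<close> is known before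
  the decision for slot \<open>t\<close>, the idle cost never overshoots \<open>\<beta>\<^sub>j\<close> and no additive loss occurs.\<close>

section \<open>Slot costs\<close>

lemma ereal_member_le_sum:
  fixes f :: "'a \<Rightarrow> ereal"
  assumes "finite A" "i \<in> A" "\<And>i. i \<in> A \<Longrightarrow> 0 \<le> f i"
  shows "f i \<le> sum f A"
  using sum_mono2[of A "{i}" f] assms by auto

definition idle_cost :: "dc_problem \<Rightarrow> nat \<Rightarrow> nat \<Rightarrow> real" where
  "idle_cost I j t = real_of_ereal (opcost I t j 0)"

lemma operating_cost_fun_real:
  assumes "operating_cost_fun c f" "0 \<le> z" "z \<le> c"
  shows "f z = ereal (real_of_ereal (f z))" "0 \<le> real_of_ereal (f z)"
proof -
  have "0 \<le> f z" "f z < \<infinity>"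
    using assms by (auto simp: operating_cost_fun_def)
  then show "f z = ereal (real_of_ereal (f z))" "0 \<le> real_of_ereal (f z)"
    by (auto simp: ereal_real real_of_ereal_pos)
qed

lemma operating_cost_fun_ge_idle:
  assumes f: "operating_cost_fun c f" and "0 < c" "0 \<le> z"
  shows "f 0 \<le> f z"
proof (cases "z \<le> c")
  case True
  have "mono_on {0..c} f"
    using f by (simp add: operating_cost_fun_def)
  then show ?thesis
    using True assms by (auto simp: mono_on_def)
next
  case False
  then show ?thesis
    using f by (simp add: operating_cost_fun_def)
qed

text \<open>The perspective \<open>x f(w/x)\<close> of a convex function grows by at most \<open>f 0\<close> per unit of \<open>x\<close>.\<close>

lemma perspective_le:
  fixes x y :: nat
  assumes f: "operating_cost_fun c f" and "0 < c" "0 \<le> w" "0 < y" "y \<le> x"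
  shows "ereal (real x) * f (w / real x)
    \<le> ereal (real y) * f (w / real y) + ereal (real_of_ereal (f 0) * (real x - real y))"
proof (cases "w / real y \<le> c")
  case False
  then have "f (w / real y) = \<infinity>"
    using f by (simp add: operating_cost_fun_def)
  then show ?thesis
    using \<open>0 < y\<close> by simp
next
  case True
  let ?F = "\<lambda>z. real_of_ereal (f z)"
  \<comment> \<open>\<open>w / x\<close> is the convex combination of the idle load \<open>0\<close>
    and \<open>w / y\<close>, with weight \<open>y / x\<close> on the latter.\<close>
  define t where "t = real y / real x"
  have xy: "0 < real x" "0 < real y" "real y \<le> real x"
    using assms by auto
  have t: "0 \<le> t" "t \<le> 1" and tx: "real x * t = real y"
    using xy by (auto simp: t_def)
  have wy: "0 \<le> w / real y" using assms by simp
  have split: "w / real x = (1 - t) * 0 + t * (w / real y)"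
    using xy by (simp add: t_def field_simps)
  have wx: "0 \<le> w / real x" "w / real x \<le> c"
    using assms True mult_left_le_one_le[OF wy t] split t by auto
  have "convex_on {0..c} ?F"
    using f by (simp add: operating_cost_fun_def)
  from convex_onD[OF this t, of 0 "w / real y"]
  have "?F (w / real x) \<le> (1 - t) * ?F 0 + t * ?F (w / real y)"
    using True wy \<open>0 < c\<close> by (simp only: split) simp
  then have "real x * ?F (w / real x) \<le> real x * ((1 - t) * ?F 0 + t * ?F (w / real y))"
    using xy by simp
  also have "\<dots> = real x * t * ?F (w / real y) + ?F 0 * (real x - real x * t)"
    by (simp add: algebra_simps)
  finally have "real x * ?F (w / real x) \<le> real y * ?F (w / real y) + ?F 0 * (real x - real y)"
    by (simp only: tx)
  moreover have "f (w / real x) = ereal (?F (w / real x))" "f (w / real y) = ereal (?F (w / real y))"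
    using operating_cost_fun_real(1)[OF f] wx wy True by auto
  ultimately show ?thesis
    by (metis ereal_less_eq(3) plus_ereal.simps(1) times_ereal.simps(1))
qed

section \<open>Cost of a single server type in one slot\<close>

context
  fixes I :: dc_problem and t j :: nat
  assumes inst: "dc_instance I" and t: "t \<in> {1..horizon I}" and j: "j \<in> {1..ntypes I}"
begin

lemma opcost_fun: "operating_cost_fun (capacity I j) (opcost I t j)"
  and capacity_pos: "0 < capacity I j"
  and volume_nonneg: "0 \<le> volume I t"
  using inst t j by (auto simp: dc_instance_def)

lemma idle_cost_nonneg: "0 \<le> idle_cost I j t"
  using operating_cost_fun_real(2)[OF opcost_fun, of 0] capacity_pos by (simp add: idle_cost_def)

lemma opcost_zero: "opcost I t j 0 = ereal (idle_cost I j t)"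
  using operating_cost_fun_real(1)[OF opcost_fun, of 0] capacity_pos by (simp add: idle_cost_def)

lemma type_cost_ge_idle:
  assumes "0 \<le> z"
  shows "ereal (idle_cost I j t * real x) \<le> type_cost I t j x z"
proof (cases "x = 0")
  case False
  have "opcost I t j 0 \<le> opcost I t j (volume I t * z / real x)"
    using operating_cost_fun_ge_idle[OF opcost_fun capacity_pos] assms volume_nonneg by simp
  then have "ereal (real x) * opcost I t j 0
      \<le> ereal (real x) * opcost I t j (volume I t * z / real x)"
    by (intro ereal_mult_left_mono) auto
  then show ?thesis
    using False by (simp add: type_cost_def opcost_zero mult.commute)
qed (simp add: type_cost_def)

lemma type_cost_nonneg:
  assumes "0 \<le> z"
  shows "0 \<le> type_cost I t j x z"
  using order_trans[OF _ type_cost_ge_idle[OF assms, of x]] idle_cost_nonneg by simp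

lemma type_cost_le_add_idle:
  assumes "0 \<le> z" "y \<le> x"
  shows "type_cost I t j x z \<le> type_cost I t j y z + ereal (idle_cost I j t * (real x - real y))"
proof (cases "y = 0")
  case False
  then show ?thesis
    using perspective_le[OF opcost_fun capacity_pos, of "volume I t * z" y x] assms volume_nonneg
    by (simp add: type_cost_def idle_cost_def)
next
  case True
  \<comment> \<open>Without load, \<open>x\<close> idle servers cost exactly the added term; with
    load, zero servers already cost \<infinity> on the right.\<close>
  show ?thesis
  proof (cases "volume I t * z = 0")
    case True
    then show ?thesis
      using \<open>y = 0\<close> by (auto simp add: type_cost_def opcost_zero mult.commute)
  next
    case False
    then have "0 < volume I t * z"
      using assms volume_nonneg by (simp add: order_less_le)
    then show ?thesis
      using \<open>y = 0\<close> by (simp add: type_cost_def)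
  qed
qed

lemma type_cost_finite_capacity:
  assumes "type_cost I t j x z < \<infinity>"
  shows "volume I t * z \<le> real x * capacity I j"
proof (cases "x = 0")
  case True
  then show ?thesis
    using assms by (auto simp: type_cost_def split: if_splits)
next
  case False
  have "volume I t * z / real x \<le> capacity I j"
  proof (rule ccontr)
    assume "\<not> ?thesis"
    then have "opcost I t j (volume I t * z / real x) = \<infinity>"
      using opcost_fun by (simp add: operating_cost_fun_def)
    then show False
      using assms False by (simp add: type_cost_def)
  qed
  then show ?thesis
    using False by (simp add: field_simps)
qed

lemma type_cost_finite:
  assumes "0 \<le> z" "volume I t * z \<le> real x * capacity I j"
  shows "type_cost I t j x z < \<infinity>"
proof (cases "x = 0")
  case True
  then show ?thesis
    using assms by (simp add: type_cost_def)
next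
  case False
  have "volume I t * z / real x \<le> capacity I j" "0 \<le> volume I t * z / real x"
    using False assms volume_nonneg by (auto simp: field_simps)
  then have "opcost I t j (volume I t * z / real x)
      = ereal (real_of_ereal (opcost I t j (volume I t * z / real x)))"
    using operating_cost_fun_real(1)[OF opcost_fun] by blast
  then have "ereal (real x) * opcost I t j (volume I t * z / real x)
      = ereal (real x * real_of_ereal (opcost I t j (volume I t * z / real x)))"
    by (metis times_ereal.simps(1))
  then show ?thesis
    using False by (simp add: type_cost_def)
qed

end

section \<open>Cost of a slot over all server types\<close>

lemma slot_cost_ge_idle:
  assumes "dc_instance I" "t \<in> {1..horizon I}" "j \<in> {1..ntypes I}"
  shows "ereal (idle_cost I j t * real (x j)) \<le> slot_cost I t x"
  unfolding slot_cost_def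
proof (rule INF_greatest)
  fix z assume z: "z \<in> load_splits (ntypes I)"
  have "ereal (idle_cost I j t * real (x j)) \<le> type_cost I t j (x j) (z j)"
    using type_cost_ge_idle[OF assms] z assms(3) by (simp add: load_splits_def)
  also have "\<dots> \<le> (\<Sum>j=1..ntypes I. type_cost I t j (x j) (z j))"
    using assms z type_cost_nonneg[OF assms(1,2)]
    by (intro ereal_member_le_sum[where f = "\<lambda>j. type_cost I t j (x j) (z j)"]) (auto simp: load_splits_def)
  finally show "ereal (idle_cost I j t * real (x j)) \<le> \<dots>" .
qed

lemma slot_cost_nonneg:
  assumes "dc_instance I" "t \<in> {1..horizon I}"
  shows "0 \<le> slot_cost I t x"
  unfolding slot_cost_def
  using type_cost_nonneg[OF assms] by (intro INF_greatest sum_nonneg) (auto simp: load_splits_def)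

lemma slot_cost_le_add_idle:
  assumes "dc_instance I" "t \<in> {1..horizon I}"
    and le: "\<And>j. j \<in> {1..ntypes I} \<Longrightarrow> y j \<le> x j"
  shows "slot_cost I t x
    \<le> slot_cost I t y + ereal (\<Sum>j=1..ntypes I. idle_cost I j t * (real (x j) - real (y j)))"
    (is "_ \<le> _ + ereal ?e")
proof -
  \<comment> \<open>Moving the real number \<open>?e\<close> to the left leaves a bare infimum on
    the right, so that each split \<open>z\<close> for \<open>y\<close> can be reused for
    \<open>x\<close>.\<close>
  have "slot_cost I t x - ereal ?e \<le> slot_cost I t y"
    unfolding slot_cost_def[of I t y]
  proof (rule INF_greatest)
    fix z assume z: "z \<in> load_splits (ntypes I)"
    have "slot_cost I t x \<le> (\<Sum>j=1..ntypes I. type_cost I t j (x j) (z j))"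
      unfolding slot_cost_def by (rule INF_lower[OF z])
    also have "\<dots> \<le> (\<Sum>j=1..ntypes I. type_cost I t j (y j) (z j)
        + ereal (idle_cost I j t * (real (x j) - real (y j))))"
      using z le by (intro sum_mono type_cost_le_add_idle[OF assms(1,2)]) (auto simp: load_splits_def)
    also have "\<dots> = (\<Sum>j=1..ntypes I. type_cost I t j (y j) (z j)) + ereal ?e"
      by (simp add: sum.distrib)
    finally show "slot_cost I t x - ereal ?e \<le> (\<Sum>j=1..ntypes I. type_cost I t j (y j) (z j))"
      by (simp add: ereal_minus_le)
  qed
  then show ?thesis
    by (simp add: ereal_minus_le)
qed

text \<open>Turns the capacity constraint into finiteness of cost, so that feasibility can later be
  read off from cost bounds.\<close>

lemma slot_cost_finite_iff:
  assumes inst: "dc_instance I" and t: "t \<in> {1..horizon I}"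
  shows "slot_cost I t x < \<infinity> \<longleftrightarrow> volume I t \<le> (\<Sum>j=1..ntypes I. real (x j) * capacity I j)"
    (is "_ \<longleftrightarrow> _ \<le> ?c")
proof
  assume "slot_cost I t x < \<infinity>"
  then obtain z where z: "z \<in> load_splits (ntypes I)"
    and fin: "(\<Sum>j=1..ntypes I. type_cost I t j (x j) (z j)) < \<infinity>"
    unfolding slot_cost_def INF_less_iff by blast
  have "type_cost I t j (x j) (z j) < \<infinity>" if "j \<in> {1..ntypes I}" for j
  proof -
    have "type_cost I t j (x j) (z j) \<le> (\<Sum>j=1..ntypes I. type_cost I t j (x j) (z j))"
      using that z type_cost_nonneg[OF inst t]
      by (intro ereal_member_le_sum[where f = "\<lambda>j. type_cost I t j (x j) (z j)"]) (auto simp: load_splits_def)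
    then show ?thesis
      using fin by (rule le_less_trans)
  qed
  then have "(\<Sum>j=1..ntypes I. volume I t * z j) \<le> ?c"
    by (intro sum_mono type_cost_finite_capacity[OF inst t])
  moreover have "(\<Sum>j=1..ntypes I. volume I t * z j) = volume I t"
    using z by (simp add: load_splits_def flip: sum_distrib_left)
  ultimately show "volume I t \<le> ?c" by simp
next
  assume vol: "volume I t \<le> ?c"
  have d: "1 \<in> {1..ntypes I}" and nn: "0 \<le> volume I t"
    and cap: "\<And>j. j \<in> {1..ntypes I} \<Longrightarrow> 0 \<le> real (x j) * capacity I j"
    using inst t by (auto simp: dc_instance_def less_imp_le)
  \<comment> \<open>Load is shared in proportion to the running capacity. If that capacity is zero,
    so is the volume, and type \<open>1\<close> formally takes everything.\<close>
  define z where "z j = (if ?c = 0 then if j = 1 then 1 else 0 else real (x j) * capacity I j / ?c)" for j :: nat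
  have c0: "0 \<le> ?c" using cap by (intro sum_nonneg) auto
  have z: "z \<in> load_splits (ntypes I)"
  proof (cases "?c = 0")
    case True
    then show ?thesis
      using d by (auto simp: load_splits_def z_def)
  next
    case False
    have "real (x j) * capacity I j \<le> ?c" if "j \<in> {1..ntypes I}" for j
      using that cap by (intro member_le_sum) auto
    moreover have "(\<Sum>j=1..ntypes I. z j) = 1"
      using False by (simp add: z_def flip: sum_divide_distrib)
    ultimately show ?thesis
      using False c0 cap by (auto simp: load_splits_def z_def divide_le_eq_1)
  qed
  have "type_cost I t j (x j) (z j) < \<infinity>" if "j \<in> {1..ntypes I}" for j
  proof (rule type_cost_finite[OF inst t that])
    show "0 \<le> z j" using z that by (simp add: load_splits_def)
    show "volume I t * z j \<le> real (x j) * capacity I j"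
    proof (cases "?c = 0")
      case True
      then show ?thesis using vol nn cap[OF that] by simp
    next
      case False
      then have "volume I t * z j \<le> ?c * z j"
        using vol \<open>0 \<le> z j\<close> by (intro mult_right_mono)
      also have "\<dots> = real (x j) * capacity I j"
        using False by (simp add: z_def)
      finally show ?thesis .
    qed
  qed
  then have "(\<Sum>j=1..ntypes I. type_cost I t j (x j) (z j)) < \<infinity>"
    by (auto simp: less_top[symmetric] sum_Pinfty)
  then show "slot_cost I t x < \<infinity>"
    unfolding slot_cost_def INF_less_iff using z by blast
qed

section \<open>Optimal schedules for prefixes of an instance\<close>

definition prefix_cost :: "dc_problem \<Rightarrow> nat \<Rightarrow> schedule \<Rightarrow> ereal" where
  "prefix_cost I t X =
     (\<Sum>s=1..t. slot_cost I s (X s) +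
        ereal (\<Sum>j=1..ntypes I. swcost I j * max (real (X s j) - real (X (s - 1) j)) 0))"

text \<open>Capacity is enforced through the cost: within the horizon of an instance, a slot with
  too little capacity costs \<infinity>. Hence minimisers exist on infeasible instances too, and the
  algorithm is defined there.\<close>

definition prefix_schedule :: "dc_problem \<Rightarrow> nat \<Rightarrow> schedule \<Rightarrow> bool" where
  "prefix_schedule I t X \<longleftrightarrow>
     (\<forall>j\<in>{1..ntypes I}. X 0 j = 0 \<and> (\<forall>s\<in>{1..t}. X s j \<le> servers I j))"

definition prefix_optimal :: "dc_problem \<Rightarrow> nat \<Rightarrow> schedule \<Rightarrow> bool" where
  "prefix_optimal I t X \<longleftrightarrow> prefix_schedule I t X \<and>
     (\<forall>Y. prefix_schedule I t Y \<longrightarrow> prefix_cost I t X \<le> prefix_cost I t Y)"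

lemma prefix_cost_0 [simp]: "prefix_cost I 0 X = 0"
  by (simp add: prefix_cost_def)

lemma prefix_cost_Suc:
  "prefix_cost I (Suc t) X = prefix_cost I t X + (slot_cost I (Suc t) (X (Suc t)) +
     ereal (\<Sum>j=1..ntypes I. swcost I j * max (real (X (Suc t) j) - real (X t j)) 0))"
  by (simp add: prefix_cost_def)

lemma schedule_cost_eq_prefix_cost: "schedule_cost I X = prefix_cost I (horizon I) X"
  by (simp add: schedule_cost_def prefix_cost_def)

lemma prefix_schedule_mono: "prefix_schedule I t X \<Longrightarrow> s \<le> t \<Longrightarrow> prefix_schedule I s X"
  by (auto simp: prefix_schedule_def)

lemma is_schedule_prefix: "is_schedule I X \<Longrightarrow> prefix_schedule I (horizon I) X"
  by (auto simp: prefix_schedule_def is_schedule_def)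

lemma slot_cost_cong:
  "(\<And>j. j \<in> {1..ntypes I} \<Longrightarrow> x j = y j) \<Longrightarrow> slot_cost I t x = slot_cost I t y"
  unfolding slot_cost_def by (intro INF_cong sum.cong) auto

lemma prefix_cost_cong:
  assumes "\<And>s j. s \<le> t \<Longrightarrow> j \<in> {1..ntypes I} \<Longrightarrow> X s j = Y s j"
  shows "prefix_cost I t X = prefix_cost I t Y"
  unfolding prefix_cost_def
  using assms by (intro sum.cong refl arg_cong2[where f = plus] slot_cost_cong arg_cong[where f = ereal]) auto

text \<open>The cost depends only on entries in a finite box, all bounded by the total number
  \<open>M\<close> of servers, so only finitely many cost values occur.\<close>

lemma prefix_optimal_exists: "\<exists>X. prefix_optimal I t X"
proof -
  define M where "M = (\<Sum>j=1..ntypes I. servers I j)"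
  define \<Phi> :: "(nat \<times> nat \<Rightarrow> nat) \<Rightarrow> schedule" where "\<Phi> F = (\<lambda>s j. F (s, j))" for F
  let ?B = "{0..t} \<times> {1..ntypes I}"
  let ?S = "Collect (prefix_schedule I t)"
  have "prefix_cost I t ` ?S \<subseteq> (prefix_cost I t \<circ> \<Phi>) ` (?B \<rightarrow>\<^sub>E {0..M})"
  proof
    fix c assume "c \<in> prefix_cost I t ` ?S"
    then obtain X where X: "prefix_schedule I t X" and c: "c = prefix_cost I t X" by auto
    have le: "X s j \<le> M" if "s \<le> t" "j \<in> {1..ntypes I}" for s j
    proof -
      have "X s j \<le> servers I j"
        using X that by (cases "s = 0") (auto simp: prefix_schedule_def)
      also have "\<dots> \<le> M"
        unfolding M_def using that by (intro member_le_sum) auto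
      finally show ?thesis .
    qed
    let ?F = "restrict (\<lambda>(s, j). X s j) ?B"
    have "?F \<in> ?B \<rightarrow>\<^sub>E {0..M}" using le by auto
    moreover have "c = (prefix_cost I t \<circ> \<Phi>) ?F"
      unfolding c comp_def by (rule prefix_cost_cong) (auto simp: \<Phi>_def)
    ultimately show "c \<in> (prefix_cost I t \<circ> \<Phi>) ` (?B \<rightarrow>\<^sub>E {0..M})" by blast
  qed
  moreover have "finite (?B \<rightarrow>\<^sub>E {0..M})" by (intro finite_PiE) auto
  ultimately have fin: "finite (prefix_cost I t ` ?S)"
    using finite_surj by blast
  have ne: "(\<lambda>_ _. 0) \<in> ?S" by (simp add: prefix_schedule_def)
  have "Min (prefix_cost I t ` ?S) \<in> prefix_cost I t ` ?S"
    using fin ne by (intro Min_in) auto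
  then obtain X where "X \<in> ?S" "prefix_cost I t X = Min (prefix_cost I t ` ?S)" by auto
  then show ?thesis
    using fin by (auto simp: prefix_optimal_def)
qed

text \<open>Minimisers chosen for different \<open>t\<close> need not extend one another; only the
  last state of each is kept.\<close>

definition demand :: "dc_problem \<Rightarrow> nat \<Rightarrow> nat \<Rightarrow> nat" where
  "demand I j t = (SOME X. prefix_optimal I t X) t j"

lemma demand_prefix_optimal:
  obtains X where "prefix_optimal I t X" "\<And>j. demand I j t = X t j"
  using someI_ex[OF prefix_optimal_exists] by (auto simp: demand_def)

lemma demand_le_servers: "1 \<le> t \<Longrightarrow> j \<in> {1..ntypes I} \<Longrightarrow> demand I j t \<le> servers I j"
  by (rule demand_prefix_optimal[of I t]) (auto simp: prefix_optimal_def prefix_schedule_def)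

section \<open>Dependence of the demand on revealed information\<close>

lemma same_information_mono: "same_information t I I' \<Longrightarrow> s \<le> t \<Longrightarrow> same_information s I I'"
  by (auto simp: same_information_def)

lemma slot_cost_same_information:
  assumes "dc_instance I" "same_information t I I'" "s \<in> {1..t}" "t \<le> horizon I"
  shows "slot_cost I s x = slot_cost I' s x"
proof -
  have d: "ntypes I' = ntypes I" and v: "volume I' s = volume I s"
    and f: "\<And>j z. j \<in> {1..ntypes I} \<Longrightarrow> 0 \<le> z \<Longrightarrow> opcost I' s j z = opcost I s j z"
    using assms by (auto simp: same_information_def)
  \<comment> \<open>Operating costs are known to agree at nonnegative loads only.\<close>
  have "0 \<le> volume I s" using assms by (auto simp: dc_instance_def)
  then have "type_cost I s j y z = type_cost I' s j y z" if "j \<in> {1..ntypes I}" "0 \<le> z" for j y z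
    using that by (simp add: type_cost_def v f)
  then show ?thesis
    unfolding slot_cost_def d by (intro INF_cong sum.cong) (auto simp: load_splits_def)
qed

text \<open>The choice made by \<open>SOME\<close> is determined by the predicate
  \<open>prefix_optimal I t\<close>. Both instances yield the same predicate, hence the same
  minimiser.\<close>

lemma demand_same_information:
  assumes "dc_instance I" "same_information t I I'" "t \<le> horizon I"
  shows "demand I j t = demand I' j t"
proof -
  have d: "ntypes I' = ntypes I" and
    m: "\<And>j. j \<in> {1..ntypes I} \<Longrightarrow> servers I' j = servers I j \<and> swcost I' j = swcost I j"
    using assms by (auto simp: same_information_def)
  have "prefix_cost I t = prefix_cost I' t"
    unfolding prefix_cost_def d
    using slot_cost_same_information[OF assms(1,2) _ assms(3)] m
    by (intro ext sum.cong refl arg_cong2[where f = plus] arg_cong[where f = ereal]) auto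
  moreover have "prefix_schedule I t = prefix_schedule I' t"
    using m by (auto simp: fun_eq_iff prefix_schedule_def d)
  ultimately show ?thesis
    by (simp add: demand_def prefix_optimal_def)
qed

lemma sum_slot_cost_demand_le:
  assumes "dc_instance I" "t \<le> horizon I" "prefix_schedule I t X"
  shows "(\<Sum>s=1..t. slot_cost I s (\<lambda>j. demand I j s)) \<le> prefix_cost I t X"
  using assms(2,3)
proof (induction t arbitrary: X)
  case (Suc t)
  obtain Y where Y: "prefix_optimal I (Suc t) Y" "\<And>j. demand I j (Suc t) = Y (Suc t) j"
    by (rule demand_prefix_optimal[of I "Suc t"]) blast
  have pY: "prefix_schedule I t Y"
    using Y(1) prefix_schedule_mono[of I "Suc t" Y t] by (simp add: prefix_optimal_def)
  have sw: "0 \<le> ereal (\<Sum>j=1..ntypes I. swcost I j * max (real (Y (Suc t) j) - real (Y t j)) 0)"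
    using assms(1) by (auto simp: dc_instance_def less_imp_le intro!: sum_nonneg mult_nonneg_nonneg)
  have "(\<Sum>s=1..Suc t. slot_cost I s (\<lambda>j. demand I j s))
      = (\<Sum>s=1..t. slot_cost I s (\<lambda>j. demand I j s)) + slot_cost I (Suc t) (Y (Suc t))"
    by (simp add: Y(2))
  \<comment> \<open>The induction hypothesis is used for the truncated optimum \<open>Y\<close> of
    the longer prefix; the given \<open>X\<close> enters only through the optimality of
    \<open>Y\<close>.\<close>
  also have "\<dots> \<le> prefix_cost I t Y + slot_cost I (Suc t) (Y (Suc t))"
    using Suc.IH[OF _ pY] Suc.prems by (intro add_right_mono) auto
  also have "\<dots> \<le> prefix_cost I (Suc t) Y"
    unfolding prefix_cost_Suc using add_left_mono[OF sw] by (intro add_left_mono) (metis add.right_neutral)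
  also have "\<dots> \<le> prefix_cost I (Suc t) X"
    using Y(1) Suc.prems by (simp add: prefix_optimal_def)
  finally show ?case .
qed simp

lemma feasible_schedule_cost_finite:
  assumes "dc_instance I" "feasible I X"
  shows "\<exists>r\<ge>0. schedule_cost I X = ereal r"
proof -
  have nn: "0 \<le> schedule_cost I X"
    unfolding schedule_cost_def
    using assms slot_cost_nonneg[OF assms(1)]
    by (intro sum_nonneg add_nonneg_nonneg)
      (auto simp: dc_instance_def less_imp_le intro!: sum_nonneg mult_nonneg_nonneg)
  have "slot_cost I t (X t) < \<infinity>" if "t \<in> {1..horizon I}" for t
    using slot_cost_finite_iff[OF assms(1) that] assms(2) that by (simp add: feasible_def)
  then have "schedule_cost I X \<noteq> \<infinity>"
    unfolding schedule_cost_def by (force simp: sum_Pinfty)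
  then show ?thesis
    using nn by (cases "schedule_cost I X") auto
qed

section \<open>Lanes\<close>

text \<open>The servers of one type are split into lanes: lane \<open>i\<close> is requested in slot \<open>t\<close> if
  \<open>i \<le> h t\<close>, where \<open>h\<close> is the demand. Its debt is the idle cost since the last request, capped at
  the switching cost \<open>b\<close>; it is credited to \<open>lane_gain\<close> at the next request.\<close>

fun lane_debt :: "real \<Rightarrow> (nat \<Rightarrow> real) \<Rightarrow> (nat \<Rightarrow> nat) \<Rightarrow> nat \<Rightarrow> nat \<Rightarrow> real" where
  "lane_debt b l h i 0 = b"
| "lane_debt b l h i (Suc t) = (if i \<le> h (Suc t) then 0 else min b (lane_debt b l h i t + l (Suc t)))"

text \<open>An unrequested lane survives a slot only if the idle cost of that slot still fits into
  the budget \<open>b\<close>.\<close>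

fun lane_on :: "real \<Rightarrow> (nat \<Rightarrow> real) \<Rightarrow> (nat \<Rightarrow> nat) \<Rightarrow> nat \<Rightarrow> nat \<Rightarrow> bool" where
  "lane_on b l h i 0 = False"
| "lane_on b l h i (Suc t) \<longleftrightarrow>
     i \<le> h (Suc t) \<or> lane_on b l h i t \<and> lane_debt b l h i t + l (Suc t) \<le> b"

text \<open>The credit includes the idle cost of the requesting slot itself, which a schedule
  running the server in that slot pays as well.\<close>

fun lane_gain :: "real \<Rightarrow> (nat \<Rightarrow> real) \<Rightarrow> (nat \<Rightarrow> nat) \<Rightarrow> nat \<Rightarrow> nat \<Rightarrow> real" where
  "lane_gain b l h i 0 = 0"
| "lane_gain b l h i (Suc t) = lane_gain b l h i t +
     (if i \<le> h (Suc t) then min b (lane_debt b l h i t + l (Suc t)) else 0)"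

text \<open>Idle costs of requested slots are not charged to the lane.\<close>

fun lane_cost :: "real \<Rightarrow> (nat \<Rightarrow> real) \<Rightarrow> (nat \<Rightarrow> nat) \<Rightarrow> nat \<Rightarrow> nat \<Rightarrow> real" where
  "lane_cost b l h i 0 = 0"
| "lane_cost b l h i (Suc t) = lane_cost b l h i t +
     (if lane_on b l h i (Suc t) \<and> h (Suc t) < i then l (Suc t) else 0) +
     (if lane_on b l h i (Suc t) \<and> \<not> lane_on b l h i t then b else 0)"

section \<open>Ski-rental analysis of a single lane\<close>

lemma lane_debt_bounds:
  assumes "0 \<le> b" "\<And>s. s \<in> {1..t} \<Longrightarrow> 0 \<le> l s"
  shows "0 \<le> lane_debt b l h i t \<and> lane_debt b l h i t \<le> b"
  using assms by (induction t) auto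

text \<open>Shutdown happens only when the cap is exceeded, and the initial debt is
  \<open>b\<close>. So each switching cost is matched by a full credit of \<open>b\<close>.\<close>

lemma lane_debt_off:
  assumes "\<not> lane_on b l h i t" "0 \<le> b" "\<And>s. s \<in> {1..t} \<Longrightarrow> 0 \<le> l s"
  shows "lane_debt b l h i t = b"
  using assms
proof (induction t)
  case (Suc t)
  have "0 \<le> l (Suc t)" using Suc.prems by simp
  then show ?case using Suc by (cases "lane_on b l h i t") auto
qed simp

text \<open>Amortisation with the debt as potential; \<open>- b\<close> cancels its initial value.
  Idling raises cost and debt alike. A request to a running lane credits at least the debt it
  clears; a request to a stopped lane credits \<open>2 * b\<close>, which covers clearing the debt
  \<open>b\<close> and switching on.\<close>

lemma lane_cost_le_debt:
  assumes "0 \<le> b" "\<And>s. s \<in> {1..t} \<Longrightarrow> 0 \<le> l s"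
  shows "lane_cost b l h i t \<le> 2 * lane_gain b l h i t + lane_debt b l h i t - b"
  using assms
proof (induction t)
  case (Suc t)
  have l: "0 \<le> l (Suc t)" and nn: "\<And>s. s \<in> {1..t} \<Longrightarrow> 0 \<le> l s" using Suc.prems by auto
  show ?case
    using Suc.IH[OF \<open>0 \<le> b\<close> nn] lane_debt_off[of b l h i t] lane_debt_bounds[of b t l h i] l \<open>0 \<le> b\<close> nn
    by (cases "lane_on b l h i t") (auto simp: min_def)
qed simp

lemma lane_cost_le_gain:
  assumes "0 \<le> b" "\<And>s. s \<in> {1..t} \<Longrightarrow> 0 \<le> l s"
  shows "lane_cost b l h i t \<le> 2 * lane_gain b l h i t"
  using lane_cost_le_debt[of b t l h i] lane_debt_bounds[of b t l h i] assms by simp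

section \<open>From lanes to numbers of servers\<close>

definition lanes_on :: "real \<Rightarrow> (nat \<Rightarrow> real) \<Rightarrow> (nat \<Rightarrow> nat) \<Rightarrow> nat \<Rightarrow> nat \<Rightarrow> nat set" where
  "lanes_on b l h m t = {i\<in>{1..m}. lane_on b l h i t}"

lemma finite_lanes_on [simp]: "finite (lanes_on b l h m t)"
  by (simp add: lanes_on_def)

lemma card_lanes_on_le: "card (lanes_on b l h m t) \<le> m"
proof -
  have "lanes_on b l h m t \<subseteq> {1..m}" by (auto simp: lanes_on_def)
  then show ?thesis using card_mono[of "{1..m}" "lanes_on b l h m t"] by simp
qed

lemma requested_lanes_on:
  assumes "1 \<le> t" "h t \<le> m"
  shows "{1..h t} \<subseteq> lanes_on b l h m t"
  using assms by (cases t) (auto simp: lanes_on_def)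

text \<open>All requested lanes are on, so the surplus over the demand consists of the unrequested
  lanes still running.\<close>

lemma lanes_idle_cost:
  assumes "1 \<le> t" "h t \<le> m"
  shows "c * (real (card (lanes_on b l h m t)) - real (h t))
    = (\<Sum>i=1..m. if lane_on b l h i t \<and> h t < i then c else 0)"
proof -
  let ?S = "lanes_on b l h m t"
  have "real (card (?S - {1..h t})) = real (card ?S) - real (h t)"
    using card_Diff_subset[OF _ requested_lanes_on[of t h m b l]] requested_lanes_on[of t h m b l] assms
      card_mono[of ?S "{1..h t}"] by simp
  moreover have "?S - {1..h t} = {i\<in>{1..m}. lane_on b l h i t \<and> h t < i}"
    by (auto simp: lanes_on_def)
  ultimately show ?thesis
    by (simp add: sum.If_cases Int_def mult.commute)
qed

text \<open>The net growth of a set is at most the number of its new elements.\<close>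

lemma lanes_switching_cost:
  assumes "0 \<le> c"
  shows "c * max (real (card (lanes_on b l h m (Suc t))) - real (card (lanes_on b l h m t))) 0
    \<le> (\<Sum>i=1..m. if lane_on b l h i (Suc t) \<and> \<not> lane_on b l h i t then c else 0)"
proof -
  let ?S = "lanes_on b l h m (Suc t)" and ?S' = "lanes_on b l h m t"
  have "card ?S - card ?S' \<le> card (?S - ?S')"
    by (rule diff_card_le_card_Diff) simp
  then have "max (real (card ?S) - real (card ?S')) 0 \<le> real (card (?S - ?S'))"
    by linarith
  then have "c * max (real (card ?S) - real (card ?S')) 0 \<le> c * real (card (?S - ?S'))"
    using assms by (rule mult_left_mono)
  moreover have "?S - ?S' = {i\<in>{1..m}. lane_on b l h i (Suc t) \<and> \<not> lane_on b l h i t}"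
    unfolding lanes_on_def by blast
  ultimately show ?thesis
    by (simp add: sum.If_cases Int_def mult.commute del: lane_on.simps)
qed

lemma lanes_cost_le:
  assumes "0 \<le> b" "\<And>s. s \<in> {1..t} \<Longrightarrow> h s \<le> m"
  shows "(\<Sum>s=1..t. l s * (real (card (lanes_on b l h m s)) - real (h s)) +
      b * max (real (card (lanes_on b l h m s)) - real (card (lanes_on b l h m (s - 1)))) 0)
    \<le> (\<Sum>i=1..m. lane_cost b l h i t)"
  using assms(2)
proof (induction t)
  case (Suc t)
  have "l (Suc t) * (real (card (lanes_on b l h m (Suc t))) - real (h (Suc t)))
      + b * max (real (card (lanes_on b l h m (Suc t))) - real (card (lanes_on b l h m t))) 0
    \<le> (\<Sum>i=1..m. if lane_on b l h i (Suc t) \<and> h (Suc t) < i then l (Suc t) else 0)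
      + (\<Sum>i=1..m. if lane_on b l h i (Suc t) \<and> \<not> lane_on b l h i t then b else 0)"
    using Suc.prems by (intro add_mono eq_refl[OF lanes_idle_cost] lanes_switching_cost assms(1)) auto
  then show ?case
    using Suc by (simp add: sum.distrib del: lane_on.simps)
qed simp

section \<open>Lower bound on the optimal cost\<close>

context
  fixes I :: dc_problem and j :: nat
  assumes inst: "dc_instance I" and j: "j \<in> {1..ntypes I}"
begin

abbreviation (input) "debt \<equiv> lane_debt (swcost I j) (idle_cost I j) (demand I j)"
abbreviation (input) "gain \<equiv> lane_gain (swcost I j) (idle_cost I j) (demand I j)"

text \<open>Of a slot's cost only the idle and switching costs of type \<open>j\<close> are kept, so
  the lower bound can treat each type separately.\<close>

lemma prefix_cost_step_ge:
  assumes "Suc t \<le> horizon I"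
  shows "prefix_cost I t X + ereal (idle_cost I j (Suc t) * real (X (Suc t) j)
      + swcost I j * max (real (X (Suc t) j) - real (X t j)) 0) \<le> prefix_cost I (Suc t) X"
proof -
  have "swcost I j * max (real (X (Suc t) j) - real (X t j)) 0
      \<le> (\<Sum>j=1..ntypes I. swcost I j * max (real (X (Suc t) j) - real (X t j)) 0)"
    using inst j by (intro member_le_sum) (auto simp: dc_instance_def less_imp_le)
  moreover have "ereal (idle_cost I j (Suc t) * real (X (Suc t) j)) \<le> slot_cost I (Suc t) (X (Suc t))"
    using slot_cost_ge_idle[OF inst _ j] assms by simp
  ultimately show ?thesis
    unfolding prefix_cost_Suc plus_ereal.simps(1)[symmetric]
    by (intro add_left_mono add_mono) auto
qed

text \<open>The work function of type \<open>j\<close> dominates a separable function of the lanes: gains plus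
  debts bound the cost of any prefix schedule from which \<open>n\<close> servers are then powered up.\<close>

lemma gain_debt_le_prefix_cost:
  assumes "t \<le> horizon I" "prefix_schedule I t X"
  shows "ereal ((\<Sum>i=1..servers I j. gain i t) + (\<Sum>i=1..n. debt i t))
    \<le> prefix_cost I t X + ereal (swcost I j * max (real n - real (X t j)) 0)"
  using assms
proof (induction t arbitrary: X n)
  case 0
  then show ?case using j by (simp add: prefix_schedule_def mult.commute)
next
  case (Suc t)
  let ?b = "swcost I j" and ?l = "idle_cost I j (Suc t)" and ?h = "demand I j (Suc t)"
  let ?m = "servers I j"
  define K where "K = (\<Sum>i=1..?m. gain i t)"
  \<comment> \<open>The debt after charging the new slot, before any request clears it.\<close>
  define v where "v i = min ?b (debt i t + ?l)" for i
  have b: "0 \<le> ?b" using inst j by (auto simp: dc_instance_def less_imp_le)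
  have l: "0 \<le> ?l" using idle_cost_nonneg[OF inst _ j] Suc.prems by simp
  \<comment> \<open>The invariant with the new slot paid for but the new demand not yet
    applied.\<close>
  have pre: "ereal (K + (\<Sum>i=1..n. v i))
      \<le> prefix_cost I (Suc t) Y + ereal (?b * max (real n - real (Y (Suc t) j)) 0)"
    if Y: "prefix_schedule I (Suc t) Y" for Y n
  proof -
    \<comment> \<open>The first \<open>k\<close> lanes are charged their idle cost, paid by servers
      of \<open>Y\<close> running in the new slot. The remaining \<open>n - k\<close> lanes are
      charged \<open>b\<close> each, paid by the final power-up. The induction hypothesis is taken
      at \<open>k\<close>.\<close>
    define k where "k = min n (Y (Suc t) j)"
    have "(\<Sum>i=1..n. v i) = (\<Sum>i=1..k. v i) + (\<Sum>i=k+1..n. v i)"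
      using sum.ub_add_nat[of 1 k v "n - k"] by (simp add: k_def)
    also have "\<dots> \<le> (\<Sum>i=1..k. debt i t + ?l) + (\<Sum>i=k+1..n. ?b)"
      by (intro add_mono sum_mono) (auto simp: v_def)
    also have "\<dots> = (\<Sum>i=1..k. debt i t) + real k * ?l + (real n - real k) * ?b"
      by (simp add: sum.distrib k_def of_nat_diff)
    finally have 1: "K + (\<Sum>i=1..n. v i)
      \<le> K + (\<Sum>i=1..k. debt i t) + (real k * ?l + (real n - real k) * ?b)" by simp
    have "?b * (max (real k - real (Y t j)) 0 + (real n - real k))
        \<le> ?b * (max (real (Y (Suc t) j) - real (Y t j)) 0 + max (real n - real (Y (Suc t) j)) 0)"
      using b by (intro mult_left_mono) (auto simp: k_def)
    moreover have "real k * ?l \<le> ?l * real (Y (Suc t) j)"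
      using l by (subst mult.commute, intro mult_left_mono) (auto simp: k_def)
    ultimately have 2: "?b * max (real k - real (Y t j)) 0 + (real k * ?l + (real n - real k) * ?b)
        \<le> (?l * real (Y (Suc t) j) + ?b * max (real (Y (Suc t) j) - real (Y t j)) 0)
          + ?b * max (real n - real (Y (Suc t) j)) 0"
      by (simp add: algebra_simps)
    have "ereal (K + (\<Sum>i=1..n. v i))
      \<le> ereal (K + (\<Sum>i=1..k. debt i t)) + ereal (real k * ?l + (real n - real k) * ?b)"
      using 1 by simp
    also have "\<dots> \<le> (prefix_cost I t Y + ereal (?b * max (real k - real (Y t j)) 0))
        + ereal (real k * ?l + (real n - real k) * ?b)"
      unfolding K_def using Suc.prems prefix_schedule_mono[OF Y] by (intro add_right_mono Suc.IH) auto
    also have "\<dots> \<le> prefix_cost I t Y + ereal ((?l * real (Y (Suc t) j)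
        + ?b * max (real (Y (Suc t) j) - real (Y t j)) 0) + ?b * max (real n - real (Y (Suc t) j)) 0)"
      using 2 by (simp add: add.assoc add_left_mono)
    also have "\<dots> \<le> prefix_cost I (Suc t) Y + ereal (?b * max (real n - real (Y (Suc t) j)) 0)"
      using add_right_mono[OF prefix_cost_step_ge[OF Suc.prems(1), of Y],
          of "ereal (?b * max (real n - real (Y (Suc t) j)) 0)"] by (simp add: add.assoc)
    finally show ?thesis .
  qed
  obtain Y where Y: "prefix_optimal I (Suc t) Y" "?h = Y (Suc t) j"
    by (rule demand_prefix_optimal[of I "Suc t"]) blast
  have hm: "?h \<le> ?m" using demand_le_servers[OF _ j] by simp
  have "(\<Sum>i=1..?m. if i \<le> ?h then v i else 0) = (\<Sum>i=1..?h. v i)"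
    using hm by (intro sum.mono_neutral_cong_right) auto
  then have gain': "(\<Sum>i=1..?m. gain i (Suc t)) = K + (\<Sum>i=1..?h. v i)"
    by (simp add: K_def v_def sum.distrib cong: if_cong)
  show ?case
  proof (cases "n \<le> ?h")
    \<comment> \<open>All \<open>n\<close> debts have been cleared, so the left side no longer
      depends on \<open>n\<close>. It is bounded by \<open>pre\<close> for the optimal
      \<open>Y\<close> at \<open>n = ?h\<close>, where nothing remains to be powered up, and
      \<open>Y\<close> costs no more than \<open>X\<close>.\<close>
    case True
    have "ereal (K + (\<Sum>i=1..?h. v i)) \<le> prefix_cost I (Suc t) Y"
      using pre[of Y ?h] Y by (simp add: prefix_optimal_def flip: zero_ereal_def)
    also have "\<dots> \<le> prefix_cost I (Suc t) X + 0"
      using Y Suc.prems by (simp add: prefix_optimal_def)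
    also have "\<dots> \<le> prefix_cost I (Suc t) X + ereal (?b * max (real n - real (X (Suc t) j)) 0)"
      using b by (intro add_left_mono) auto
    finally show ?thesis
      using True by (simp only: gain') simp
  next
    \<comment> \<open>Credits for lanes up to \<open>?h\<close> and remaining debts beyond it
      recombine to the sum in \<open>pre\<close>, now used for \<open>X\<close> itself.\<close>
    case False
    have "(\<Sum>i=1..n. debt i (Suc t)) = (\<Sum>i=?h+1..n. v i)"
      using False by (intro sum.mono_neutral_cong_right) (auto simp: v_def)
    moreover have "(\<Sum>i=1..n. v i) = (\<Sum>i=1..?h. v i) + (\<Sum>i=?h+1..n. v i)"
      using sum.ub_add_nat[of 1 ?h v "n - ?h"] False by simp
    ultimately show ?thesis
      using pre[OF Suc.prems(2), of n] by (simp only: gain' add.assoc)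
  qed
qed

lemma gain_le_schedule_cost:
  assumes "is_schedule I X"
  shows "ereal (\<Sum>i=1..servers I j. gain i (horizon I)) \<le> schedule_cost I X"
proof -
  have "ereal (\<Sum>i=1..servers I j. gain i (horizon I))
      \<le> prefix_cost I (horizon I) X + ereal (swcost I j * max (real 0 - real (X (horizon I) j)) 0)"
    using gain_debt_le_prefix_cost[OF order_refl is_schedule_prefix[OF assms], of 0] by simp
  then show ?thesis
    by (simp add: schedule_cost_eq_prefix_cost flip: zero_ereal_def)
qed

end

section \<open>The online algorithm\<close>

text \<open>The value \<open>0\<close> outside the horizon supplies the boundary states of a
  schedule.\<close>

definition right_size :: "dc_problem \<Rightarrow> schedule" where
  "right_size I t j = (if t \<in> {1..horizon I}
     then card (lanes_on (swcost I j) (idle_cost I j) (demand I j) (servers I j) t) else 0)"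

lemma is_schedule_right_size: "is_schedule I (right_size I)"
  by (auto simp: is_schedule_def right_size_def card_lanes_on_le)

text \<open>Both parts go through one induction because \<open>lane_on\<close> consults the previous
  debt.\<close>

lemma lane_debt_on_cong:
  assumes "\<And>s. s \<in> {1..t} \<Longrightarrow> l s = l' s" "\<And>s. s \<in> {1..t} \<Longrightarrow> h s = h' s"
  shows "lane_debt b l h i t = lane_debt b l' h' i t \<and> lane_on b l h i t = lane_on b l' h' i t"
  using assms by (induction t) auto

lemma online_algorithm_right_size: "online_algorithm right_size"
  unfolding online_algorithm_def
proof (intro conjI allI impI ballI is_schedule_right_size)
  fix I I' t j
  assume inst: "dc_instance I" and t: "t \<in> {1..horizon I}" and same: "same_information t I I'"
    and j: "j \<in> {1..ntypes I}"
  have "demand I j s = demand I' j s" if "s \<in> {1..t}" for s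
    using demand_same_information[OF inst same_information_mono[OF same, of s]] that t by simp
  moreover have "idle_cost I j s = idle_cost I' j s" if "s \<in> {1..t}" for s
    using same that j by (simp add: same_information_def idle_cost_def)
  ultimately have "lane_on (swcost I j) (idle_cost I j) (demand I j) i t
      = lane_on (swcost I j) (idle_cost I' j) (demand I' j) i t" for i
    using lane_debt_on_cong by blast
  then show "right_size I t j = right_size I' t j"
    using same j by (simp add: right_size_def lanes_on_def same_information_def)
qed

section \<open>Feasibility and cost of the algorithm\<close>

lemma demand_le_right_size:
  assumes "t \<in> {1..horizon I}" "j \<in> {1..ntypes I}"
  shows "demand I j t \<le> right_size I t j"
  using assms demand_le_servers[of t j I] requested_lanes_on[of t "demand I j" "servers I j"]
    card_mono[OF finite_lanes_on, of "{1..demand I j t}"]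
  by (simp add: right_size_def)

text \<open>A feasible schedule bounds the total cost of the demands by a finite value. Each demand
  thus has enough capacity, and running more servers preserves this.\<close>

lemma feasible_right_size:
  assumes inst: "dc_instance I" and X: "feasible I X"
  shows "feasible I (right_size I)"
  unfolding feasible_def
proof (intro conjI ballI is_schedule_right_size)
  fix t assume t: "t \<in> {1..horizon I}"
  let ?D = "\<lambda>s. slot_cost I s (\<lambda>j. demand I j s)"
  have "?D t \<le> (\<Sum>s=1..horizon I. ?D s)"
    using t slot_cost_nonneg[OF inst] by (intro ereal_member_le_sum[where f = ?D]) auto
  also have "\<dots> \<le> schedule_cost I X"
    unfolding schedule_cost_eq_prefix_cost
    using X by (intro sum_slot_cost_demand_le inst is_schedule_prefix) (auto simp: feasible_def)
  also have "\<dots> < \<infinity>"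
    using feasible_schedule_cost_finite[OF inst X] by auto
  finally have "volume I t \<le> (\<Sum>j=1..ntypes I. real (demand I j t) * capacity I j)"
    using slot_cost_finite_iff[OF inst t, of "\<lambda>j. demand I j t"] by simp
  also have "\<dots> \<le> (\<Sum>j=1..ntypes I. real (right_size I t j) * capacity I j)"
    using inst demand_le_right_size[OF t]
    by (intro sum_mono mult_right_mono) (auto simp: dc_instance_def less_imp_le)
  finally show "volume I t \<le> (\<Sum>j=1..ntypes I. real (right_size I t j) * capacity I j)" .
qed

lemma type_overhead_le:
  assumes inst: "dc_instance I" and j: "j \<in> {1..ntypes I}" and X: "is_schedule I X"
    and r: "schedule_cost I X = ereal r"
  shows "(\<Sum>t=1..horizon I. idle_cost I j t * (real (right_size I t j) - real (demand I j t))
      + swcost I j * max (real (right_size I t j) - real (right_size I (t - 1) j)) 0) \<le> 2 * r"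
proof -
  let ?b = "swcost I j" and ?l = "idle_cost I j" and ?h = "demand I j" and ?m = "servers I j"
  let ?T = "horizon I"
  have b: "0 \<le> ?b" using inst j by (auto simp: dc_instance_def less_imp_le)
  \<comment> \<open>At \<open>t = 0\<close> no lane is on, so the lane count also covers the
    predecessor of the first slot.\<close>
  have A: "right_size I t j = card (lanes_on ?b ?l ?h ?m t)" if "t \<le> ?T" for t
    using that by (cases "t = 0") (auto simp: right_size_def lanes_on_def)
  have "(\<Sum>t=1..?T. ?l t * (real (right_size I t j) - real (?h t))
      + ?b * max (real (right_size I t j) - real (right_size I (t - 1) j)) 0)
    = (\<Sum>t=1..?T. ?l t * (real (card (lanes_on ?b ?l ?h ?m t)) - real (?h t)) +
      ?b * max (real (card (lanes_on ?b ?l ?h ?m t)) - real (card (lanes_on ?b ?l ?h ?m (t - 1)))) 0)"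
    by (intro sum.cong refl) (auto simp: A)
  also have "\<dots> \<le> (\<Sum>i=1..?m. lane_cost ?b ?l ?h i ?T)"
    using demand_le_servers[OF _ j] by (intro lanes_cost_le b) auto
  also have "\<dots> \<le> (\<Sum>i=1..?m. 2 * lane_gain ?b ?l ?h i ?T)"
    using idle_cost_nonneg[OF inst _ j] by (intro sum_mono lane_cost_le_gain b) auto
  also have "\<dots> \<le> 2 * r"
    using gain_le_schedule_cost[OF inst j X] r by (simp flip: sum_distrib_left)
  finally show ?thesis .
qed

lemma right_size_cost_le:
  assumes inst: "dc_instance I" and X: "feasible I X"
  shows "schedule_cost I (right_size I) \<le> ereal (2 * real (ntypes I) + 1) * schedule_cost I X"
proof -
  obtain r where r: "schedule_cost I X = ereal r"
    using feasible_schedule_cost_finite[OF inst X] by auto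
  have sched: "is_schedule I X" using X by (simp add: feasible_def)
  let ?A = "right_size I" and ?d = "ntypes I"
  let ?D = "\<lambda>t. slot_cost I t (\<lambda>j. demand I j t)"
  let ?e = "\<lambda>t j. idle_cost I j t * (real (?A t j) - real (demand I j t))"
  let ?s = "\<lambda>t j. swcost I j * max (real (?A t j) - real (?A (t - 1) j)) 0"
  have "schedule_cost I ?A \<le> (\<Sum>t=1..horizon I. (?D t + ereal (\<Sum>j=1..?d. ?e t j)) + ereal (\<Sum>j=1..?d. ?s t j))"
    unfolding schedule_cost_def
    by (intro sum_mono add_right_mono slot_cost_le_add_idle inst demand_le_right_size)
  also have "\<dots> = (\<Sum>t=1..horizon I. ?D t) + ereal (\<Sum>t=1..horizon I. \<Sum>j=1..?d. ?e t j + ?s t j)"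
    by (simp add: sum.distrib add.assoc)
  \<comment> \<open>Summing over slots first lets each of the \<open>d\<close> types be charged
    \<open>2 * r\<close>; the demands account for one further \<open>r\<close>.\<close>
  also have "\<dots> = (\<Sum>t=1..horizon I. ?D t) + ereal (\<Sum>j=1..?d. \<Sum>t=1..horizon I. ?e t j + ?s t j)"
    by (subst sum.swap) simp
  also have "\<dots> \<le> ereal r + ereal (\<Sum>j=1..?d. 2 * r)"
  proof (rule add_mono)
    show "(\<Sum>t=1..horizon I. ?D t) \<le> ereal r"
      unfolding r[symmetric] schedule_cost_eq_prefix_cost
      by (intro sum_slot_cost_demand_le inst is_schedule_prefix sched) simp
    show "ereal (\<Sum>j=1..?d. \<Sum>t=1..horizon I. ?e t j + ?s t j) \<le> ereal (\<Sum>j=1..?d. 2 * r)"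
      unfolding ereal_less_eq(3) by (intro sum_mono type_overhead_le[OF inst _ sched r])
  qed
  also have "\<dots> = ereal (2 * real ?d + 1) * schedule_cost I X"
    by (simp add: r algebra_simps)
  finally show ?thesis .
qed

theorem theorem15:
  fixes \<epsilon> :: real
  assumes "\<epsilon> > 0"
  shows "\<exists>A. online_algorithm A \<and> (\<forall>d\<ge>1. competitive A d (2 * real d + 1 + \<epsilon>))"
proof (intro exI[of _ right_size] conjI allI impI online_algorithm_right_size)
  fix d :: nat
  show "competitive right_size d (2 * real d + 1 + \<epsilon>)"
    unfolding competitive_def
  proof (intro allI impI conjI)
    fix I assume inst: "dc_instance I" and d: "ntypes I = d" and "\<exists>X. feasible I X"
    then show "feasible I (right_size I)" using feasible_right_size by blast
    fix X assume "optimal I X"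
    then have X: "feasible I X" by (simp add: optimal_def)
    obtain r where r: "0 \<le> r" "schedule_cost I X = ereal r"
      using feasible_schedule_cost_finite[OF inst X] by auto
    have "schedule_cost I (right_size I) \<le> ereal (2 * real d + 1) * schedule_cost I X"
      using right_size_cost_le[OF inst X] d by simp
    \<comment> \<open>The cost \<open>r\<close> is nonnegative, so enlarging the factor by
      \<epsilon> keeps the bound.\<close>
    also have "\<dots> \<le> ereal (2 * real d + 1 + \<epsilon>) * schedule_cost I X"
      using r assms by (simp add: mult_right_mono)
    finally show "schedule_cost I (right_size I) \<le> ereal (2 * real d + 1 + \<epsilon>) * schedule_cost I X" .
  qed
qed

end
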